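(* Let $m,n$ be positive integers and let $\mathcal{A}^I=[\underline{\mathcal{A}},\overline{\mathcal{A}}]$ be an interval tensor in $T_{m,n}$. For $i\in[n]$ and $(i_2,\dots,i_m)\neq(i,\dots,i)$ put $$S(i;i_2,\dots,i_m)=\max\Big\{0,\sum_{\substack{(k_2,\dots,k_m)\neq(i,\dots,i)\\(k_2,\dots,k_m)\neq(i_2,\dots,i_m)}}(\overline{a}_{i i_2\cdots i_m}-\underline{a}_{i k_2\cdots k_m})\Big\},\qquad R(i)=\max\Big\{0,-\sum_{(k_2,\dots,k_m)\neq(i,\dots,i)}\underline{a}_{i k_2\cdots k_m}\Big\}.$$ Then $\mathcal{A}^I$ is an interval double B-tensor if and only if the following hold: (a) for each $i_1\in[n]$, $\underline{a}_{i_1i_1\cdots i_1}>\max\{0,\overline{a}_{i_1i_2\cdots i_m}:(i_2,\dots,i_m)\neq(i_1,\dots,i_1)\}$; (b) for all $i_1\in[n]$ and all $(i_2,\dots,i_m)\neq(i_1,\dots,i_1)$: (b$_1$) $\underline{a}_{i_1i_1\cdots i_1}-\overline{a}_{i_1i_2\cdots i_m}\ge S(i_1;i_2,\dots,i_m)$; (b$_2$) $\underline{a}_{i_1i_1\cdots i_1}\ge R(i_1)$; (c) for all $i_1,j_1\in[n]$ with $i_1\neq j_1$, and all $(i_2,\dots,i_m)\neq(i_1,\dots,i_1)$, $(j_2,\dots,j_m)\neq(j_1,\dots,j_1)$: (c$_1$) $(\underline{a}_{i_1i_1\cdots i_1}-\overline{a}_{i_1i_2\cdots i_m})(\underline{a}_{j_1j_1\cdots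 j_1}-\overline{a}_{j_1j_2\cdots j_m})>S(i_1;i_2,\dots,i_m)\,S(j_1;j_2,\dots,j_m)$; (c$_2$) $(\underline{a}_{i_1i_1\cdots i_1}-\overline{a}_{i_1i_2\cdots i_m})\,\underline{a}_{j_1j_1\cdots j_1}>S(i_1;i_2,\dots,i_m)\,R(j_1)$; (c$_3$) $\underline{a}_{i_1i_1\cdots i_1}\,\underline{a}_{j_1j_1\cdots j_1}>R(i_1)\,R(j_1)$.
   Context: $[n]=\{1,\dots,n\}$. $T_{m,n}$ is the set of real tensors $\mathcal{A}=(a_{i_1i_2\cdots i_m})$ with all indices in $[n]$. All index tuples $(i_2,\dots,i_m)$, $(j_2,\dots,j_m)$, $(k_2,\dots,k_m)$ range over $[n]^{m-1}$. For $\underline{\mathcal{A}}=(\underline{a}_{i_1\cdots i_m})\le\overline{\mathcal{A}}=(\overline{a}_{i_1\cdots i_m})$ in $T_{m,n}$ (entrywise), the interval tensor is $\mathcal{A}^I=[\underline{\mathcal{A}},\overline{\mathcal{A}}]=\{\mathcal{A}\in T_{m,n}:\underline{\mathcal{A}}\le\mathcal{A}\le\overline{\mathcal{A}}\}$. For $\mathcal{A}\in T_{m,n}$ and $i_1\in[n]$, $\gamma_{i_1}^+(\mathcal{A}):=\max\{0,a_{i_1i_2\cdots i_m}:(i_2,\dots,i_m)\neq(i_1,\dots,i_1)\}$ (the maximum of $0$ and the listed entries). Double B-tensor: $\mathcal{A}\in T_{m,n}$ is a double B-tensor if for all $i_1\in[n]$: (i) $a_{i_1i_1\cdots i_1}>\gamma_{i_1}^+(\mathcal{A})$;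 (ii) $a_{i_1i_1\cdots i_1}-\gamma_{i_1}^+(\mathcal{A})\ge\sum_{(i_2,\dots,i_m)\neq(i_1,\dots,i_1)}(\gamma_{i_1}^+(\mathcal{A})-a_{i_1i_2\cdots i_m})$; (iii) for all $j_1\neq i_1$, $$(a_{i_1\cdots i_1}-\gamma_{i_1}^+(\mathcal{A}))(a_{j_1\cdots j_1}-\gamma_{j_1}^+(\mathcal{A}))>\Big(\sum_{(i_2,\dots,i_m)\neq(i_1,\dots,i_1)}(\gamma_{i_1}^+(\mathcal{A})-a_{i_1i_2\cdots i_m})\Big)\Big(\sum_{(j_2,\dots,j_m)\neq(j_1,\dots,j_1)}(\gamma_{j_1}^+(\mathcal{A})-a_{j_1j_2\cdots j_m})\Big).$$ $\mathcal{A}^I$ is an interval double B-tensor if every $\mathcal{A}\in\mathcal{A}^I$ is a double B-tensor. *)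

theory Defs
  imports Complex_Main "HOL-Library.FuncSet"
begin

(* A multi-index is a list; the first index of an entry is split off by Cons, so the
   entry a_{i i_2 ... i_m} is A (i # t) with t = [i_2, ..., i_m].  For m = 1 the only
   tail is the empty list, which is the diagonal one. *)

definition tuples :: "nat \<Rightarrow> nat \<Rightarrow> nat list set" where
  "tuples k n = {t. length t = k \<and> set t \<subseteq> {1..n}}"

definition tensors :: "nat \<Rightarrow> nat \<Rightarrow> (nat list \<Rightarrow> real) set" where
  "tensors m n = tuples m n \<rightarrow>\<^sub>E UNIV"

definition tensor_le :: "nat \<Rightarrow> nat \<Rightarrow> (nat list \<Rightarrow> real) \<Rightarrow> (nat list \<Rightarrow> real) \<Rightarrow> bool" where
  "tensor_le m n A B \<longleftrightarrow> (\<forall>p\<in>tuples m n. A p \<le> B p)"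

definition interval_tensor ::
    "nat \<Rightarrow> nat \<Rightarrow> (nat list \<Rightarrow> real) \<Rightarrow> (nat list \<Rightarrow> real) \<Rightarrow> (nat list \<Rightarrow> real) set" where
  "interval_tensor m n lo hi = {A \<in> tensors m n. tensor_le m n lo A \<and> tensor_le m n A hi}"

definition diag :: "nat \<Rightarrow> (nat list \<Rightarrow> real) \<Rightarrow> nat \<Rightarrow> real" where
  "diag m A i = A (replicate m i)"

definition offdiag :: "nat \<Rightarrow> nat \<Rightarrow> nat \<Rightarrow> nat list set" where
  "offdiag m n i = tuples (m - 1) n - {replicate (m - 1) i}"

lemma finite_tuples [simp]: "finite (tuples k n)"
proof -
  have "tuples k n = {t. set t \<subseteq> {1..n} \<and> length t = k}"
    by (auto simp: tuples_def)
  then show ?thesis by (simp add: finite_lists_length_eq)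
qed

lemma finite_offdiag [simp]: "finite (offdiag m n i)"
  by (simp add: offdiag_def)

definition gamma_plus :: "nat \<Rightarrow> nat \<Rightarrow> (nat list \<Rightarrow> real) \<Rightarrow> nat \<Rightarrow> real" where
  "gamma_plus m n A i = Max (insert 0 ((\<lambda>t. A (i # t)) ` offdiag m n i))"

definition double_B_tensor :: "nat \<Rightarrow> nat \<Rightarrow> (nat list \<Rightarrow> real) \<Rightarrow> bool" where
  "double_B_tensor m n A \<longleftrightarrow>
     A \<in> tensors m n \<and>
     (\<forall>i\<in>{1..n}.
        diag m A i > gamma_plus m n A i \<and>
        diag m A i - gamma_plus m n A i
          \<ge> (\<Sum>t\<in>offdiag m n i. gamma_plus m n A i - A (i # t)) \<and>
        (\<forall>j\<in>{1..n}. j \<noteq> i \<longrightarrow>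
           (diag m A i - gamma_plus m n A i) * (diag m A j - gamma_plus m n A j)
             > (\<Sum>t\<in>offdiag m n i. gamma_plus m n A i - A (i # t))
               * (\<Sum>t\<in>offdiag m n j. gamma_plus m n A j - A (j # t))))"

definition interval_double_B_tensor ::
    "nat \<Rightarrow> nat \<Rightarrow> (nat list \<Rightarrow> real) \<Rightarrow> (nat list \<Rightarrow> real) \<Rightarrow> bool" where
  "interval_double_B_tensor m n lo hi \<longleftrightarrow>
     (\<forall>A\<in>interval_tensor m n lo hi. double_B_tensor m n A)"

definition S_bound ::
    "nat \<Rightarrow> nat \<Rightarrow> (nat list \<Rightarrow> real) \<Rightarrow> (nat list \<Rightarrow> real) \<Rightarrow> nat \<Rightarrow> nat list \<Rightarrow> real" where
  "S_bound m n lo hi i t = max 0 (\<Sum>k\<in>offdiag m n i - {t}. hi (i # t) - lo (i # k))"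

definition R_bound :: "nat \<Rightarrow> nat \<Rightarrow> (nat list \<Rightarrow> real) \<Rightarrow> nat \<Rightarrow> real" where
  "R_bound m n lo i = max 0 (- (\<Sum>k\<in>offdiag m n i. lo (i # k)))"

end

theory Submission
  imports Defs
begin

text \<open>
  Call \<open>a\<^sub>i\<^sub>i\<^sub>.\<^sub>.\<^sub>.\<^sub>i - \<gamma>\<^sub>i\<^sup>+\<close> the \<^emph>\<open>gap\<close> of row \<open>i\<close>, and the sum of the differences
  \<open>\<gamma>\<^sub>i\<^sup>+ - a\<^sub>i\<^sub>t\<close> over the off-diagonal tails \<open>t\<close> its \<^emph>\<open>deficit\<close>. Each condition of a double
  B-tensor survives when gaps grow and deficits shrink, provided gaps are positive and
  deficits nonnegative. So only extreme pairs (gap, deficit) matter.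

  The maximum \<open>\<gamma>\<^sub>i\<^sup>+\<close> is either \<open>0\<close> or one of the entries \<open>a\<^sub>i\<^sub>t\<close>. If it is \<open>0\<close>, the row is at
  worst \<open>(lo\<^sub>i\<^sub>i\<^sub>.\<^sub>.\<^sub>.\<^sub>i, R i)\<close>. If it is \<open>a\<^sub>i\<^sub>t\<close>, the term of \<open>t\<close> drops out of the deficit and the row
  is at worst \<open>(lo\<^sub>i\<^sub>i\<^sub>.\<^sub>.\<^sub>.\<^sub>i - hi\<^sub>i\<^sub>t, S i t)\<close>; this is \<open>row_dominated\<close>. Conversely, the row with all
  entries lowest, except possibly for one off-diagonal entry raised to its upper bound, is at
  least as bad as the corresponding pair, since its \<open>\<gamma>\<^sub>i\<^sup>+\<close> is at least \<open>0\<close> and at least the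
  raised entry. Rows can be chosen independently, so one member of the interval tensor is that
  bad in all rows at once; this is \<open>extremal_member\<close>. Hence the interval tensor is double B if
  and only if all these finitely many pairs satisfy the inequalities
  (\<open>interval_double_B_iff_row_bounds\<close>), and this is the asserted criterion.
\<close>

section \<open>Gap and deficit of a row\<close>

definition gap :: "nat \<Rightarrow> nat \<Rightarrow> (nat list \<Rightarrow> real) \<Rightarrow> nat \<Rightarrow> real" where
  "gap m n A i = diag m A i - gamma_plus m n A i"

definition deficit :: "nat \<Rightarrow> nat \<Rightarrow> (nat list \<Rightarrow> real) \<Rightarrow> nat \<Rightarrow> real" where
  "deficit m n A i = (\<Sum>t\<in>offdiag m n i. gamma_plus m n A i - A (i # t))"

text \<open>
  The pairs (lower bound of the gap, upper bound of the deficit), one for each possible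
  location of the maximum \<open>\<gamma>\<^sub>i\<^sup>+\<close>: first the value \<open>0\<close>, then the off-diagonal entries.
\<close>

definition row_bounds ::
    "nat \<Rightarrow> nat \<Rightarrow> (nat list \<Rightarrow> real) \<Rightarrow> (nat list \<Rightarrow> real) \<Rightarrow> nat \<Rightarrow> (real \<times> real) set" where
  "row_bounds m n lo hi i =
     insert (diag m lo i, R_bound m n lo i)
       ((\<lambda>t. (diag m lo i - hi (i # t), S_bound m n lo hi i t)) ` offdiag m n i)"

lemma double_B_tensor_iff_gap_deficit:
  "double_B_tensor m n A \<longleftrightarrow>
     A \<in> tensors m n \<and>
     (\<forall>i\<in>{1..n}. gap m n A i > 0 \<and> gap m n A i \<ge> deficit m n A i) \<and>
     (\<forall>i\<in>{1..n}. \<forall>j\<in>{1..n}. i \<noteq> j \<longrightarrow>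
        gap m n A i * gap m n A j > deficit m n A i * deficit m n A j)"
  unfolding double_B_tensor_def gap_def deficit_def by auto

lemma gamma_plus_nonneg: "gamma_plus m n A i \<ge> 0"
  unfolding gamma_plus_def by (rule Max_ge) auto

lemma gamma_plus_ge: "t \<in> offdiag m n i \<Longrightarrow> A (i # t) \<le> gamma_plus m n A i"
  unfolding gamma_plus_def by (rule Max_ge) auto

lemma gamma_plus_cases:
  obtains "gamma_plus m n A i = 0"
  | t where "t \<in> offdiag m n i" "gamma_plus m n A i = A (i # t)"
proof -
  have "gamma_plus m n A i \<in> insert 0 ((\<lambda>t. A (i # t)) ` offdiag m n i)"
    unfolding gamma_plus_def by (rule Max_in) auto
  then show thesis using that by auto
qed

lemma deficit_nonneg: "deficit m n A i \<ge> 0"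
  unfolding deficit_def by (rule sum_nonneg) (simp add: gamma_plus_ge)

lemma Cons_offdiag_in_tuples:
  "m \<ge> 1 \<Longrightarrow> i \<in> {1..n} \<Longrightarrow> t \<in> offdiag m n i \<Longrightarrow> i # t \<in> tuples m n"
  by (auto simp: offdiag_def tuples_def)

lemma replicate_in_tuples: "i \<in> {1..n} \<Longrightarrow> replicate m i \<in> tuples m n"
  by (auto simp: tuples_def)

text \<open>
  The criterion states the product inequalities involving \<open>R\<close> for every off-diagonal tail of each
  of the two rows; this quantification is vacuous in both rows or in neither.
\<close>

lemma offdiag_empty_iff:
  assumes "i \<in> {1..n}" and "j \<in> {1..n}"
  shows "offdiag m n i = {} \<longleftrightarrow> offdiag m n j = {}"
proof -
  have "card (offdiag m n k) = card (tuples (m - 1) n) - 1" if "k \<in> {1..n}" for k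
    using replicate_in_tuples[OF that, of "m - 1"] by (simp add: offdiag_def)
  then show ?thesis
    using assms by (metis card_0_eq finite_offdiag)
qed

section \<open>The worst cases of a row\<close>

text \<open>
  Entries off the location of the maximum only enter through the deficit, which decreases in
  them, so they may be replaced by their lower bounds.
\<close>

lemma row_dominated:
  assumes m: "m \<ge> 1" and i: "i \<in> {1..n}" and A: "A \<in> interval_tensor m n lo hi"
  obtains P Q where "(P, Q) \<in> row_bounds m n lo hi i"
    "P \<le> gap m n A i" "deficit m n A i \<le> Q"
proof -
  have A_bounds: "lo p \<le> A p" "A p \<le> hi p" if "p \<in> tuples m n" for p
    using A that by (auto simp: interval_tensor_def tensor_le_def)
  have diag_ge: "diag m lo i \<le> diag m A i"
    unfolding diag_def by (rule A_bounds) (rule replicate_in_tuples[OF i])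
  note row = A_bounds[OF Cons_offdiag_in_tuples[OF m i]]
  show thesis
  proof (cases rule: gamma_plus_cases[of m n A i])
    case 1
    have "(\<Sum>t\<in>offdiag m n i. 0 - A (i # t)) \<le> (\<Sum>t\<in>offdiag m n i. 0 - lo (i # t))"
      by (rule sum_mono) (simp add: row)
    then have "deficit m n A i \<le> R_bound m n lo i"
      by (simp add: deficit_def R_bound_def 1 sum_negf)
    then show thesis
      using that[of "diag m lo i" "R_bound m n lo i"] diag_ge 1
      by (simp add: row_bounds_def gap_def)
  next
    case (2 t)
    have "deficit m n A i = (\<Sum>k\<in>offdiag m n i - {t}. A (i # t) - A (i # k))"
      unfolding deficit_def 2(2) by (subst sum.remove[OF _ 2(1)]) simp_all
    also have "\<dots> \<le> (\<Sum>k\<in>offdiag m n i - {t}. hi (i # t) - lo (i # k))"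
      using row 2(1) by (intro sum_mono diff_mono) auto
    also have "\<dots> \<le> S_bound m n lo hi i t"
      by (simp add: S_bound_def)
    finally have "deficit m n A i \<le> S_bound m n lo hi i t" .
    moreover have "diag m lo i - hi (i # t) \<le> gap m n A i"
      unfolding gap_def 2(2) using diag_ge row(2)[OF 2(1)] by simp
    moreover have "(diag m lo i - hi (i # t), S_bound m n lo hi i t) \<in> row_bounds m n lo hi i"
      using 2(1) by (simp add: row_bounds_def)
    ultimately show thesis
      using that by blast
  qed
qed

text \<open>
  For the reverse bound the maximum \<open>\<gamma>\<^sub>i\<^sup>+\<close> need not be attained at the raised entry: a larger
  maximum makes the row only worse. The set \<open>T\<close> of raised positions is empty or a singleton,
  according to the kind of the pair. Quantifying over all \<open>A\<close> with the prescribed row \<open>i\<close> leaves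
  the other rows free, so that they can be prescribed independently.
\<close>

lemma row_bound_attained:
  assumes "(P, Q) \<in> row_bounds m n lo hi i"
  obtains T where "T \<subseteq> offdiag m n i"
    "\<And>A. \<lbrakk>diag m A i = diag m lo i;
          \<And>k. k \<in> offdiag m n i \<Longrightarrow> A (i # k) = (if k \<in> T then hi (i # k) else lo (i # k))\<rbrakk>
       \<Longrightarrow> gap m n A i \<le> P \<and> Q \<le> deficit m n A i"
proof -
  consider "P = diag m lo i" "Q = R_bound m n lo i"
    | t where "t \<in> offdiag m n i" "P = diag m lo i - hi (i # t)" "Q = S_bound m n lo hi i t"
    using assms by (auto simp: row_bounds_def)
  then show thesis
  proof cases
    case 1
    show thesis
    proof (rule that[of "{}"])
      fix A
      assume d: "diag m A i = diag m lo i"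
        and e: "\<And>k. k \<in> offdiag m n i \<Longrightarrow> A (i # k) = (if k \<in> {} then hi (i # k) else lo (i # k))"
      have "(\<Sum>k\<in>offdiag m n i. - lo (i # k)) \<le> deficit m n A i"
        unfolding deficit_def by (rule sum_mono) (simp add: e gamma_plus_nonneg)
      then show "gap m n A i \<le> P \<and> Q \<le> deficit m n A i"
        using 1 d by (simp add: gap_def R_bound_def sum_negf gamma_plus_nonneg deficit_nonneg)
    qed simp
  next
    case (2 t)
    show thesis
    proof (rule that[of "{t}"])
      fix A
      assume d: "diag m A i = diag m lo i"
        and e: "\<And>k. k \<in> offdiag m n i \<Longrightarrow> A (i # k) = (if k \<in> {t} then hi (i # k) else lo (i # k))"
      have g: "hi (i # t) \<le> gamma_plus m n A i"
        using gamma_plus_ge[OF 2(1), of A] e[OF 2(1)] by simp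
      have "(\<Sum>k\<in>offdiag m n i - {t}. hi (i # t) - lo (i # k))
          \<le> (\<Sum>k\<in>offdiag m n i - {t}. gamma_plus m n A i - A (i # k))"
        by (rule sum_mono) (use g e in auto)
      also have "\<dots> \<le> deficit m n A i"
        unfolding deficit_def by (rule sum_mono2) (auto simp: gamma_plus_ge)
      finally show "gap m n A i \<le> P \<and> Q \<le> deficit m n A i"
        using 2 d g by (simp add: gap_def S_bound_def deficit_nonneg)
    qed (simp add: 2)
  qed
qed

text \<open>
  Condition (iii) of a double B-tensor couples two rows, so bounds attained row by row, each by
  its own tensor, would not suffice for the necessity of the criterion.
\<close>

lemma extremal_member:
  assumes m: "m \<ge> 1" and lo: "lo \<in> tensors m n" and hi: "hi \<in> tensors m n"
    and le: "tensor_le m n lo hi"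
    and F: "\<And>i. i \<in> {1..n} \<Longrightarrow> F i \<in> row_bounds m n lo hi i"
  obtains A where "A \<in> interval_tensor m n lo hi"
    "\<And>i. i \<in> {1..n} \<Longrightarrow> gap m n A i \<le> fst (F i) \<and> snd (F i) \<le> deficit m n A i"
proof -
  define extremal where "extremal i T \<longleftrightarrow> T \<subseteq> offdiag m n i \<and>
     (\<forall>A. diag m A i = diag m lo i \<longrightarrow>
        (\<forall>k\<in>offdiag m n i. A (i # k) = (if k \<in> T then hi (i # k) else lo (i # k))) \<longrightarrow>
        gap m n A i \<le> fst (F i) \<and> snd (F i) \<le> deficit m n A i)" for i T
  have "\<forall>i\<in>{1..n}. \<exists>T. extremal i T"
  proof
    fix i assume "i \<in> {1..n}"
    then have "(fst (F i), snd (F i)) \<in> row_bounds m n lo hi i"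
      using F by simp
    then show "\<exists>T. extremal i T"
      by (rule row_bound_attained) (auto simp only: extremal_def)
  qed
  from bchoice[OF this] obtain T where T: "\<forall>i\<in>{1..n}. extremal i (T i)" ..
  \<comment> \<open>Outside the index set \<open>lo\<close> and \<open>hi\<close> are both \<open>undefined\<close>, hence so is \<open>A\<close>.\<close>
  define A where "A p = (if tl p \<in> T (hd p) then hi p else lo p)" for p
  show thesis
  proof (rule that[of A])
    show "A \<in> interval_tensor m n lo hi"
      using lo hi le
      by (auto simp: A_def interval_tensor_def tensor_le_def tensors_def PiE_def extensional_def)
    fix i assume i: "i \<in> {1..n}"
    have "replicate m i = i # replicate (m - 1) i"
      using m by (cases m) auto
    moreover have "replicate (m - 1) i \<notin> T i"
      using T i by (auto simp: extremal_def offdiag_def)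
    ultimately have "diag m A i = diag m lo i"
      by (simp add: diag_def A_def)
    moreover have "\<forall>k\<in>offdiag m n i. A (i # k) = (if k \<in> T i then hi (i # k) else lo (i # k))"
      by (simp add: A_def)
    moreover have "extremal i (T i)"
      using T i by blast
    ultimately show "gap m n A i \<le> fst (F i) \<and> snd (F i) \<le> deficit m n A i"
      unfolding extremal_def by blast
  qed
qed

section \<open>The criterion\<close>

lemma row_bounds_snd_nonneg: "(P, Q) \<in> row_bounds m n lo hi i \<Longrightarrow> Q \<ge> 0"
  by (auto simp: row_bounds_def R_bound_def S_bound_def)

lemma mult_less_transfer:
  fixes p p' q q' P P' Q Q' :: real
  assumes "Q * Q' < P * P'" and "0 \<le> q" "q \<le> Q" "0 \<le> q'" "q' \<le> Q'"
    and "0 \<le> P" "P \<le> p" "0 \<le> P'" "P' \<le> p'"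
  shows "q * q' < p * p'"
proof -
  have "q * q' \<le> Q * Q'" "P * P' \<le> p * p'"
    using assms by (auto intro!: mult_mono)
  then show ?thesis using assms(1) by linarith
qed

text \<open>
  Sufficiency compares each row of a member with a worse pair; necessity evaluates the
  conditions at the members that are as bad as the given pair or pairs.
\<close>

lemma interval_double_B_iff_row_bounds:
  assumes m: "m \<ge> 1" and lo: "lo \<in> tensors m n" and hi: "hi \<in> tensors m n"
    and le: "tensor_le m n lo hi"
  shows "interval_double_B_tensor m n lo hi \<longleftrightarrow>
    (\<forall>i\<in>{1..n}. \<forall>(P, Q)\<in>row_bounds m n lo hi i. P > 0 \<and> P \<ge> Q) \<and>
    (\<forall>i\<in>{1..n}. \<forall>j\<in>{1..n}. i \<noteq> j \<longrightarrow>
       (\<forall>(P, Q)\<in>row_bounds m n lo hi i. \<forall>(P', Q')\<in>row_bounds m n lo hi j. P * P' > Q * Q'))"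
    (is "?B \<longleftrightarrow> ?single \<and> ?double")
proof
  assume B: ?B
  \<comment> \<open>Rows other than the prescribed ones are taken lowest.\<close>
  define low where "low i = (diag m lo i, R_bound m n lo i)" for i
  have low: "low i \<in> row_bounds m n lo hi i" for i
    by (simp add: low_def row_bounds_def)
  have ?single
  proof clarify
    fix i P Q assume i: "i \<in> {1..n}" and PQ: "(P, Q) \<in> row_bounds m n lo hi i"
    obtain A where A: "A \<in> interval_tensor m n lo hi"
      and ex: "\<And>k. k \<in> {1..n} \<Longrightarrow>
        gap m n A k \<le> fst ((low(i := (P, Q))) k) \<and> snd ((low(i := (P, Q))) k) \<le> deficit m n A k"
      by (rule extremal_member[OF m lo hi le, of "low(i := (P, Q))"])
        (use PQ low in \<open>auto split: if_splits\<close>)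
    have "double_B_tensor m n A"
      using B A by (simp add: interval_double_B_tensor_def)
    then have "gap m n A i > 0" "gap m n A i \<ge> deficit m n A i"
      using i by (auto simp: double_B_tensor_iff_gap_deficit)
    then show "P > 0 \<and> P \<ge> Q"
      using ex[OF i] by auto
  qed
  moreover have ?double
  proof clarify
    fix i j P Q P' Q'
    assume i: "i \<in> {1..n}" and j: "j \<in> {1..n}" and ij: "i \<noteq> j"
      and PQ: "(P, Q) \<in> row_bounds m n lo hi i" and PQ': "(P', Q') \<in> row_bounds m n lo hi j"
    obtain A where A: "A \<in> interval_tensor m n lo hi"
      and ex: "\<And>k. k \<in> {1..n} \<Longrightarrow>
        gap m n A k \<le> fst ((low(i := (P, Q), j := (P', Q'))) k) \<and>
        snd ((low(i := (P, Q), j := (P', Q'))) k) \<le> deficit m n A k"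
      by (rule extremal_member[OF m lo hi le, of "low(i := (P, Q), j := (P', Q'))"])
        (use PQ PQ' low in \<open>auto split: if_splits\<close>)
    have D: "double_B_tensor m n A"
      using B A by (simp add: interval_double_B_tensor_def)
    show "Q * Q' < P * P'"
    proof (rule mult_less_transfer)
      show "deficit m n A i * deficit m n A j < gap m n A i * gap m n A j"
        using D i j ij by (simp add: double_B_tensor_iff_gap_deficit)
      show "0 \<le> gap m n A i" "0 \<le> gap m n A j"
        using D i j by (auto simp: double_B_tensor_iff_gap_deficit intro: less_imp_le)
    qed (use ex[OF i] ex[OF j] ij row_bounds_snd_nonneg[OF PQ] row_bounds_snd_nonneg[OF PQ'] in auto)
  qed
  ultimately show "?single \<and> ?double" ..
next
  assume R: "?single \<and> ?double"
  show ?B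
    unfolding interval_double_B_tensor_def double_B_tensor_iff_gap_deficit
  proof (intro ballI conjI impI)
    fix A assume A: "A \<in> interval_tensor m n lo hi"
    show "A \<in> tensors m n"
      using A by (simp add: interval_tensor_def)
    fix i assume i: "i \<in> {1..n}"
    obtain P Q where PQ: "(P, Q) \<in> row_bounds m n lo hi i"
      "P \<le> gap m n A i" "deficit m n A i \<le> Q"
      by (rule row_dominated[OF m i A])
    have pos: "P > 0" "P \<ge> Q"
      using R i PQ(1) by auto
    show "gap m n A i > 0" "gap m n A i \<ge> deficit m n A i"
      using pos PQ by auto
    fix j assume j: "j \<in> {1..n}" and ij: "i \<noteq> j"
    obtain P' Q' where PQ': "(P', Q') \<in> row_bounds m n lo hi j"
      "P' \<le> gap m n A j" "deficit m n A j \<le> Q'"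
      by (rule row_dominated[OF m j A])
    have pos': "P' > 0"
      using R j PQ'(1) by auto
    have "Q * Q' < P * P'"
      using R i j ij PQ(1) PQ'(1) by blast
    then show "deficit m n A i * deficit m n A j < gap m n A i * gap m n A j"
      by (rule mult_less_transfer) (use PQ PQ' pos pos' in \<open>auto simp: deficit_nonneg\<close>)
  qed
qed

theorem theorem4p1:
  fixes m n :: nat and lo hi :: "nat list \<Rightarrow> real"
  assumes "m \<ge> 1" and "n \<ge> 1"
    and "lo \<in> tensors m n" and "hi \<in> tensors m n"
    and "tensor_le m n lo hi"
  shows "interval_double_B_tensor m n lo hi \<longleftrightarrow>
    (\<forall>i\<in>{1..n}. diag m lo i > Max (insert 0 ((\<lambda>t. hi (i # t)) ` offdiag m n i))) \<and>
    (\<forall>i\<in>{1..n}. \<forall>t\<in>offdiag m n i.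
       diag m lo i - hi (i # t) \<ge> S_bound m n lo hi i t \<and>
       diag m lo i \<ge> R_bound m n lo i) \<and>
    (\<forall>i\<in>{1..n}. \<forall>j\<in>{1..n}. i \<noteq> j \<longrightarrow>
       (\<forall>t\<in>offdiag m n i. \<forall>s\<in>offdiag m n j.
          (diag m lo i - hi (i # t)) * (diag m lo j - hi (j # s))
            > S_bound m n lo hi i t * S_bound m n lo hi j s \<and>
          (diag m lo i - hi (i # t)) * diag m lo j
            > S_bound m n lo hi i t * R_bound m n lo j \<and>
          diag m lo i * diag m lo j > R_bound m n lo i * R_bound m n lo j))"
    (is "_ \<longleftrightarrow> ?a \<and> ?b \<and> ?c")
proof -
  note m = assms(1)
  define B where "B = row_bounds m n lo hi"
  let ?single = "\<forall>i\<in>{1..n}. \<forall>(P, Q)\<in>B i. P > 0 \<and> P \<ge> Q"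
  let ?double = "\<forall>i\<in>{1..n}. \<forall>j\<in>{1..n}. i \<noteq> j \<longrightarrow>
       (\<forall>(P, Q)\<in>B i. \<forall>(P', Q')\<in>B j. P * P' > Q * Q')"
  have a_iff: "?a \<longleftrightarrow> (\<forall>i\<in>{1..n}. diag m lo i > 0 \<and>
      (\<forall>t\<in>offdiag m n i. diag m lo i - hi (i # t) > 0))"
    by simp
  have B_low: "(diag m lo i, R_bound m n lo i) \<in> B i" for i
    by (simp add: B_def row_bounds_def)
  have B_raised: "(diag m lo i - hi (i # t), S_bound m n lo hi i t) \<in> B i"
    if "t \<in> offdiag m n i" for i t
    using that by (simp add: B_def row_bounds_def)
  have B_cases: "x = (diag m lo i, R_bound m n lo i) \<or>
      (\<exists>t\<in>offdiag m n i. x = (diag m lo i - hi (i # t), S_bound m n lo hi i t))"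
    if "x \<in> B i" for x i
    using that by (auto simp: B_def row_bounds_def)
  have R0: "R_bound m n lo i = 0" if "offdiag m n i = {}" for i
    using that by (simp add: R_bound_def)
  have "?single \<and> ?double \<longleftrightarrow> ?a \<and> ?b \<and> ?c"
  proof
    assume sd: "?single \<and> ?double"
    have single: "P > 0 \<and> P \<ge> Q" if "i \<in> {1..n}" "(P, Q) \<in> B i" for i P Q
      using sd that by auto
    have double: "Q * Q' < P * P'"
      if "i \<in> {1..n}" "j \<in> {1..n}" "i \<noteq> j" "(P, Q) \<in> B i" "(P', Q') \<in> B j" for i j P Q P' Q'
      using conjunct2[OF sd] that by blast
    have ?a
      unfolding a_iff using single B_low B_raised by blast
    moreover have ?b
      using single B_low B_raised by blast
    moreover have ?c
    proof (intro ballI impI conjI)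
      fix i j t s
      assume ij: "i \<in> {1..n}" "j \<in> {1..n}" "i \<noteq> j"
        and t: "t \<in> offdiag m n i" and s: "s \<in> offdiag m n j"
      note d = double[OF ij]
      show "S_bound m n lo hi i t * S_bound m n lo hi j s
          < (diag m lo i - hi (i # t)) * (diag m lo j - hi (j # s))"
        by (rule d[OF B_raised[OF t] B_raised[OF s]])
      show "S_bound m n lo hi i t * R_bound m n lo j < (diag m lo i - hi (i # t)) * diag m lo j"
        by (rule d[OF B_raised[OF t] B_low])
      show "R_bound m n lo i * R_bound m n lo j < diag m lo i * diag m lo j"
        by (rule d[OF B_low B_low])
    qed
    ultimately show "?a \<and> ?b \<and> ?c" by blast
  next
    assume abc: "?a \<and> ?b \<and> ?c"
    then have pos: "diag m lo i > 0" "\<And>t. t \<in> offdiag m n i \<Longrightarrow> diag m lo i - hi (i # t) > 0"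
      if "i \<in> {1..n}" for i
      using that unfolding a_iff by blast+
    have b: "S_bound m n lo hi i t \<le> diag m lo i - hi (i # t)" "R_bound m n lo i \<le> diag m lo i"
      if "i \<in> {1..n}" "t \<in> offdiag m n i" for i t
      using abc that by blast+
    have c: "S_bound m n lo hi i t * S_bound m n lo hi j s
          < (diag m lo i - hi (i # t)) * (diag m lo j - hi (j # s))"
        "S_bound m n lo hi i t * R_bound m n lo j < (diag m lo i - hi (i # t)) * diag m lo j"
        "R_bound m n lo i * R_bound m n lo j < diag m lo i * diag m lo j"
      if "i \<in> {1..n}" "j \<in> {1..n}" "i \<noteq> j" "t \<in> offdiag m n i" "s \<in> offdiag m n j" for i j t s
      using abc that by blast+
    \<comment> \<open>With no off-diagonal entries, the conditions on \<open>R\<close> follow from positivity of the diagonal.\<close>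
    have R_le: "R_bound m n lo i \<le> diag m lo i" if "i \<in> {1..n}" for i
    proof (cases "offdiag m n i = {}")
      case True
      then show ?thesis using R0 pos(1)[OF that] by simp
    next
      case False
      then show ?thesis using b(2)[OF that] by blast
    qed
    have R_mult: "R_bound m n lo i * R_bound m n lo j < diag m lo i * diag m lo j"
      if ij: "i \<in> {1..n}" "j \<in> {1..n}" "i \<noteq> j" for i j
    proof (cases "offdiag m n i = {}")
      case True
      then show ?thesis using R0 pos(1) ij by simp
    next
      case False
      then obtain t s where "t \<in> offdiag m n i" "s \<in> offdiag m n j"
        using offdiag_empty_iff[OF ij(1,2), of m] by blast
      then show ?thesis by (rule c(3)[OF ij])
    qed
    have SR: "S_bound m n lo hi i t * R_bound m n lo j < (diag m lo i - hi (i # t)) * diag m lo j"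
      if ij: "i \<in> {1..n}" "j \<in> {1..n}" "i \<noteq> j" and t: "t \<in> offdiag m n i" for i j t
    proof -
      obtain s where "s \<in> offdiag m n j"
        using t offdiag_empty_iff[OF ij(1,2), of m] by blast
      with t show ?thesis by (rule c(2)[OF ij])
    qed
    have ?single
    proof clarify
      fix i P Q assume i: "i \<in> {1..n}" and PQ: "(P, Q) \<in> B i"
      show "P > 0 \<and> P \<ge> Q"
        using B_cases[OF PQ] pos[OF i] R_le[OF i] b(1)[OF i] by auto
    qed
    moreover have ?double
    proof clarify
      fix i j P Q P' Q'
      assume ij: "i \<in> {1..n}" "j \<in> {1..n}" "i \<noteq> j"
        and PQ: "(P, Q) \<in> B i" and PQ': "(P', Q') \<in> B j"
      have RS: "R_bound m n lo i * S_bound m n lo hi j s < diag m lo i * (diag m lo j - hi (j # s))"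
        if "s \<in> offdiag m n j" for s
        using SR[OF ij(2,1) ij(3)[symmetric] that] by (simp only: mult.commute)
      show "Q * Q' < P * P'"
        using B_cases[OF PQ] B_cases[OF PQ'] R_mult[OF ij] SR[OF ij] RS c(1)[OF ij]
        by (elim disjE bexE) simp_all
    qed
    ultimately show "?single \<and> ?double" ..
  qed
  then show ?thesis
    using interval_double_B_iff_row_bounds[OF m assms(3-5)] unfolding B_def by (rule trans[rotated])
qed

end
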